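(* Let $N\ge 2$ be the dimension of the state space, let $a,d,\hat\mu\in\mathbb{R}$, $A\in\mathbb{R}^{(N-1)\times(N-1)}$ and $\vec b,\vec e,h_Y\in\mathbb{R}^{N-1}$, and consider the continuous piecewise linear system $x^{(k+1)}=f(x^{(k)})$, $Y^{(k+1)}=G(x^{(k)},Y^{(k)})$ on $\mathbb{R}\times\mathbb{R}^{N-1}$ given by $$f(x)=\begin{cases} a x+\hat\mu, & x\le 0\\ d x+\hat\mu, & x\ge 0\end{cases},\qquad G(x,Y)=\begin{cases}\vec b\,x+AY+h_Y, & x\le 0\\ \vec e\,x+AY+h_Y, & x\ge 0.\end{cases}$$ Let $n\ge 3$. The $n$-cycle $\mathcal{O}_{RL^{n-1}}$ of this system with $\hat\mu>0$ exists if $A$ does not have any eigenvalue equal to $1$ and $(a,d)$ belongs to the region $$\mathcal{R}_{\hat\mu>0}^{RL^{n-1}}=\left\{(a,d)\in\mathbb{R}^2 \;\Big|\; a>0,\ d<-\frac{1-a^{n-1}}{(1-a)a^{n-2}}\right\}.$$ Furthermore, a border collision bifurcation, independent of $\hat\mu$, with symbolic sequence $RL^{n-2}0$ occurs if $(a,d)$ lies on the bifurcation curve $$\mathcal{C}_{\hat\mu>0}^{RL^{n-1}}=\left\{(a,d)\in\mathbb{R}^2 \;\Big|\; a>0,\ d=-\frac{1-a^{n-1}}{(1-a)a^{n-2}}\right\},$$ such that $\mathcal{R}_{\hat\mu>0}^{RL^{n-1}}$ is bounded by the bifurcation curve $\mathcal{C}_{\hat\mu>0}^{RL^{n-1}}$.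 Similar results can be derived for $\hat\mu<0$.
   Context: The switching boundary of the system is the hyperplane $\{x=0\}$. An $n$-cycle is a periodic orbit $Z_1\mapsto Z_2\mapsto\cdots\mapsto Z_n\mapsto Z_1$ with periodic points $Z_i=(x_i,Y_i)\in\mathbb{R}\times\mathbb{R}^{N-1}$. Its symbolic sequence records, for each successive point, $R$ if $x_i>0$, $L$ if $x_i<0$, and $0$ if $x_i=0$. Thus $\mathcal{O}_{RL^{n-1}}$ denotes an $n$-cycle with $x_1>0$ and $x_2,\dots,x_n<0$, and $RL^{n-2}0$ corresponds to $x_1>0$, $x_2,\dots,x_{n-1}<0$, $x_n=0$. A border collision bifurcation arises when a fixed point or periodic point of a piecewise smooth map collides with a switching boundary at a critical value of the bifurcation parameter. The quotient $\frac{1-a^{n-1}}{1-a}$ is read as $1+a+\dots+a^{n-2}$, also at $a=1$.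
   Formalization: The condition that A has no eigenvalue equal to 1 is replaced by: A^n has no eigenvalue equal to 1. As printed the claim fails, e.g. N=2, A=(-1), n=4, b=h_Y=0, e=1, a=1, d=-4, μ̂=1, where Y_5=Y_1-x_1, so no RL^3 cycle exists. *)

theory Defs
  imports "HOL-Analysis.Analysis"
begin

(* The power instance on ('a, 'n) vec makes  A ^ n  on matrices an entrywise power,
   hence a separate definition of the matrix power. *)

primrec matrix_power :: "real^'m^'m \<Rightarrow> nat \<Rightarrow> real^'m^'m" where
  "matrix_power A 0 = mat 1"
| "matrix_power A (Suc k) = A ** matrix_power A k"

definition eigenvalue :: "real^'m^'m \<Rightarrow> real \<Rightarrow> bool" where
  "eigenvalue A c \<longleftrightarrow> (\<exists>v. v \<noteq> 0 \<and> A *v v = c *\<^sub>R v)"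

(* The state space is R x R^(N-1) with N - 1 = CARD('m), so N >= 2 holds automatically. *)

type_synonym 'm state = "real \<times> (real^'m)"

definition f_map :: "real \<Rightarrow> real \<Rightarrow> real \<Rightarrow> real \<Rightarrow> real" where
  "f_map a d \<mu> x = (if x \<le> 0 then a * x + \<mu> else d * x + \<mu>)"

definition G_map ::
  "real^'m^'m \<Rightarrow> real^'m \<Rightarrow> real^'m \<Rightarrow> real^'m \<Rightarrow> real \<Rightarrow> real^'m \<Rightarrow> real^'m" where
  "G_map A b e h x Y = (if x \<le> 0 then x *\<^sub>R b + A *v Y + h else x *\<^sub>R e + A *v Y + h)"

definition pwl_map ::
  "real \<Rightarrow> real \<Rightarrow> real \<Rightarrow> real^'m^'m \<Rightarrow> real^'m \<Rightarrow> real^'m \<Rightarrow> real^'m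
   \<Rightarrow> 'm state \<Rightarrow> 'm state" where
  "pwl_map a d \<mu> A b e h = (\<lambda>(x, Y). (f_map a d \<mu> x, G_map A b e h x Y))"

datatype symbol = SymL | SymR | Sym0

definition symbol_of :: "real \<Rightarrow> symbol" where
  "symbol_of x = (if x > 0 then SymR else if x < 0 then SymL else Sym0)"

definition symbolic_sequence :: "'m state list \<Rightarrow> symbol list" where
  "symbolic_sequence Z = map (\<lambda>z. symbol_of (fst z)) Z"

(* An n-cycle is the list [Z_1, ..., Z_n] of its points in the order in which they are
   visited; the second conjunct of is_cycle says  Z_1 |-> Z_2 |-> ... |-> Z_n |-> Z_1,
   the last one that the period n is minimal. *)

definition is_cycle :: "('s \<Rightarrow> 's) \<Rightarrow> 's list \<Rightarrow> bool" where
  "is_cycle F Z \<longleftrightarrow> Z \<noteq> [] \<and> map F Z = rotate1 Z \<and> distinct Z"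

definition cycle_with :: "('m state \<Rightarrow> 'm state) \<Rightarrow> symbol list \<Rightarrow> 'm state list \<Rightarrow> bool" where
  "cycle_with F s Z \<longleftrightarrow> is_cycle F Z \<and> symbolic_sequence Z = s"

definition existence_set ::
  "('p \<Rightarrow> 'm state \<Rightarrow> 'm state) \<Rightarrow> symbol list \<Rightarrow> 'p set" where
  "existence_set \<Phi> s = {p. \<exists>Z. cycle_with (\<Phi> p) s Z}"

(* Border collision bifurcation, at the parameter value p0 of the family \<Phi>, of the cycle with
   symbolic sequence s (off the switching boundary {x = 0}).  Critical value: p0 is on the
   frontier of the set of parameters for which the s-cycle exists.  Collision: as p tends to p0
   through that set, the s-cycle converges point by point to a cycle of \<Phi> p0 which has a point
   on the boundary and whose symbolic sequence is \<sigma>. *)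

definition border_collision_bifurcation ::
  "('p::topological_space \<Rightarrow> 'm::finite state \<Rightarrow> 'm state) \<Rightarrow> symbol list \<Rightarrow> 'p \<Rightarrow> symbol list \<Rightarrow> bool" where
  "border_collision_bifurcation \<Phi> s p0 \<sigma> \<longleftrightarrow>
     length s = length \<sigma> \<and> Sym0 \<notin> set s \<and> Sym0 \<in> set \<sigma> \<and>
     p0 \<in> frontier (existence_set \<Phi> s) \<and>
     (\<exists>Z0 Z. cycle_with (\<Phi> p0) \<sigma> Z0 \<and>
        (\<forall>p \<in> existence_set \<Phi> s. cycle_with (\<Phi> p) s (Z p)) \<and>
        (\<forall>i < length \<sigma>. ((\<lambda>p. Z p ! i) \<longlongrightarrow> Z0 ! i) (at p0 within existence_set \<Phi> s)))"

(* (1 - a^(n-1)) / (1 - a), read as 1 + a + ... + a^(n-2) *)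

definition geom_quotient :: "nat \<Rightarrow> real \<Rightarrow> real" where
  "geom_quotient n a = (\<Sum>k<n - 1. a ^ k)"

definition region_pos :: "nat \<Rightarrow> (real \<times> real) set" where
  "region_pos n = {(a, d). a > 0 \<and> d < - (geom_quotient n a / a ^ (n - 2))}"

definition curve_pos :: "nat \<Rightarrow> (real \<times> real) set" where
  "curve_pos n = {(a, d). a > 0 \<and> d = - (geom_quotient n a / a ^ (n - 2))}"

(* For negative \<mu>, the reflection x |-> -x turns the system into one of the same form with
   \<mu> negated, the roles of a and d exchanged, and the symbols L and R exchanged. *)

definition region_neg :: "nat \<Rightarrow> (real \<times> real) set" where
  "region_neg n = {(a, d). d > 0 \<and> a < - (geom_quotient n d / d ^ (n - 2))}"

definition curve_neg :: "nat \<Rightarrow> (real \<times> real) set" where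
  "curve_neg n = {(a, d). d > 0 \<and> a = - (geom_quotient n d / d ^ (n - 2))}"

(* The Y-components of an n-cycle solve  (I - A^n) Y_1 = c,  so the nondegeneracy condition
   used with these definitions is that 1 is not an eigenvalue of A^n, i.e. that no eigenvalue
   of A is an n-th root of unity.  Excluding only the eigenvalue 1 of A itself is not enough:
   for A = (-1), n = 4, b = h = 0, e = 1, following an orbit with the signs R L L L through
   one period gives  Y_5 = Y_1 - x_1,  which is not Y_1. *)

end

theory Submission
  imports Defs
begin

text \<open>
  The x-component decouples. A cycle with one point \<open>x\<close> on the right and all others on the left
  passes through the left branch \<open>n - 1\<close> times, so \<open>x (1 - a\<^sup>n\<^sup>-\<^sup>1 d) = \<mu> (1 + a + \<dots> + a\<^sup>n\<^sup>-\<^sup>1)\<close>; for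
  \<open>\<mu> > 0\<close> the sign pattern forces \<open>a > 0\<close>, and then, running the increasing left branch backwards,
  the pattern holds iff \<open>0 < x < \<mu>\<close>, which is the region. On the curve \<open>x = \<mu>\<close>, whose preimage is the
  boundary point \<open>0\<close>. The Y-component of the starting point is the unique solution of a linear
  equation with matrix \<open>1 - A\<^sup>n\<close>, and depends continuously on the parameters because the map
  is jointly continuous in the parameters and the state. The case \<open>\<mu> < 0\<close> follows by reflecting \<open>x\<close>.
\<close>

section \<open>Cycles as lists of iterates\<close>

text \<open>If two of the points agree, at times \<open>i < j\<close>, then \<open>n - j\<close>
  further steps lead to a return to \<open>z\<close> at time \<open>n - j + i\<close>, which lies
  strictly between \<open>0\<close> and \<open>n\<close>.\<close>

lemma is_cycle_iterates:
  assumes "n > 0" "(F ^^ n) z = z" and ne: "\<And>k. 0 < k \<Longrightarrow> k < n \<Longrightarrow> (F ^^ k) z \<noteq> z"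
  shows "is_cycle F (map (\<lambda>k. (F ^^ k) z) [0..<n])"
proof -
  have "(F ^^ i) z \<noteq> (F ^^ j) z" if "i < j" "j < n" for i j
  proof
    assume eq: "(F ^^ i) z = (F ^^ j) z"
    have "(F ^^ (n - j + i)) z = (F ^^ (n - j + j)) z"
      by (simp only: funpow_add o_apply eq)
    with that assms(2) have "(F ^^ (n - j + i)) z = z" by simp
    with ne[of "n - j + i"] that show False by auto
  qed
  then have "inj_on (\<lambda>k. (F ^^ k) z) {0..<n}"
    by (intro linorder_inj_onI') auto
  moreover have "map F (map (\<lambda>k. (F ^^ k) z) [0..<n]) = rotate1 (map (\<lambda>k. (F ^^ k) z) [0..<n])"
  proof (rule nth_equalityI)
    fix i assume "i < length (map F (map (\<lambda>k. (F ^^ k) z) [0..<n]))"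
    then show "map F (map (\<lambda>k. (F ^^ k) z) [0..<n]) ! i = rotate1 (map (\<lambda>k. (F ^^ k) z) [0..<n]) ! i"
      using assms(2) by (cases "Suc i = n") (auto simp: nth_rotate1)
  qed simp
  ultimately show ?thesis
    using \<open>n > 0\<close> by (simp add: is_cycle_def distinct_map)
qed

lemma is_cycle_nth:
  assumes "is_cycle F Z" "i < length Z"
  shows "F (Z ! i) = Z ! (Suc i mod length Z)"
  using assms by (metis is_cycle_def nth_map nth_rotate1)

section \<open>Iterates of the map and their continuity\<close>

text \<open>Without a case distinction, limits can be taken term by term, also at points of the
  switching boundary.\<close>

lemma pwl_map_min_max:
  "pwl_map a d \<mu> A b e h z =
     (a * min (fst z) 0 + d * max (fst z) 0 + \<mu>,
      min (fst z) 0 *\<^sub>R b + max (fst z) 0 *\<^sub>R e + A *v snd z + h)"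
  by (auto simp: pwl_map_def f_map_def G_map_def split_beta)

lemma fst_funpow_pwl_map:
  "fst ((pwl_map a d \<mu> A b e h ^^ k) (x, Y)) = (f_map a d \<mu> ^^ k) x"
  by (induction k) (auto simp: pwl_map_def split_beta)

text \<open>The \<open>x\<close>-orbit does not see \<open>Y\<close>, so the orbits of
  \<open>(x, Y)\<close> and \<open>(x, 0)\<close> receive the same forcing and their difference
  evolves by \<open>A\<close> alone. Closing up the \<open>Y\<close>-part after \<open>n\<close>
  steps thus becomes a linear equation.\<close>

lemma snd_funpow_pwl_map:
  "snd ((pwl_map a d \<mu> A b e h ^^ k) (x, Y)) =
     matrix_power A k *v Y + snd ((pwl_map a d \<mu> A b e h ^^ k) (x, 0))"
proof (induction k)
  case (Suc k)
  then show ?case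
    by (simp add: pwl_map_min_max[of a d \<mu> A b e h "(pwl_map a d \<mu> A b e h ^^ k) _"]
        fst_funpow_pwl_map matrix_vector_right_distrib matrix_vector_mul_assoc)
qed simp

lemma tendsto_pwl_map:
  assumes "(a \<longlongrightarrow> a') G" "(d \<longlongrightarrow> d') G" "(z \<longlongrightarrow> z') G"
  shows "((\<lambda>p. pwl_map (a p) (d p) \<mu> A b e h (z p)) \<longlongrightarrow> pwl_map a' d' \<mu> A b e h z') G"
  unfolding pwl_map_min_max
  by (intro tendsto_intros assms matrix_vector_mul_bounded_linear[THEN bounded_linear.tendsto])

lemma tendsto_funpow_pwl_map:
  assumes "(a \<longlongrightarrow> a') G" "(d \<longlongrightarrow> d') G" "(z \<longlongrightarrow> z') G"
  shows "((\<lambda>p. (pwl_map (a p) (d p) \<mu> A b e h ^^ k) (z p))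
           \<longlongrightarrow> (pwl_map a' d' \<mu> A b e h ^^ k) z') G"
  by (induction k) (simp_all add: assms tendsto_pwl_map)

section \<open>Solvability of the linear equation for \<open>Y\<close>\<close>

lemma matrix_inv_right:
  fixes B :: "'a::semiring_1^'n^'m"
  assumes "invertible B"
  shows "B ** matrix_inv B = mat 1"
  using assms unfolding invertible_def matrix_inv_def by (rule someI2_ex) blast

text \<open>A kernel vector of \<open>mat 1 - B\<close> is fixed by \<open>B\<close>, and a square
  matrix with trivial kernel is invertible.\<close>

lemma invertible_if_no_unit_eigenvalue:
  assumes "\<not> eigenvalue B 1"
  shows "invertible (mat 1 - B)"
proof -
  have "v = 0" if "(mat 1 - B) *v v = 0" for v
    using assms that by (auto simp: eigenvalue_def matrix_vector_mult_diff_rdistrib)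
  then show ?thesis
    by (metis invertible_left_inverse matrix_left_invertible_ker)
qed

section \<open>The scalar orbit of the right-hand point\<close>

text \<open>The images of \<open>x > 0\<close> from \<open>f x\<close> (index \<open>0\<close>) on, as long as all of them stay on the left.\<close>

definition left_orbit :: "real \<Rightarrow> real \<Rightarrow> real \<Rightarrow> real \<Rightarrow> nat \<Rightarrow> real" where
  "left_orbit a d \<mu> x k = a ^ k * (d * x) + \<mu> * (\<Sum>i<Suc k. a ^ i)"

lemma left_orbit_0 [simp]: "left_orbit a d \<mu> x 0 = d * x + \<mu>"
  by (simp add: left_orbit_def)

lemma left_orbit_Suc: "left_orbit a d \<mu> x (Suc k) = a * left_orbit a d \<mu> x k + \<mu>"
  unfolding left_orbit_def sum.lessThan_Suc_shift[of _ "Suc k"]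
  by (simp add: algebra_simps sum_distrib_left del: sum.lessThan_Suc)

text \<open>Since \<open>a * y + \<mu> \<le> 0\<close> forces \<open>y < 0\<close>, negativity
  spreads backwards from the last point, which may itself be \<open>0\<close>.\<close>

lemma left_orbit_neg:
  assumes "a > 0" "\<mu> > 0" "left_orbit a d \<mu> x m \<le> 0" "k < m"
  shows "left_orbit a d \<mu> x k < 0"
  using assms(3,4)
proof (induction m)
  case (Suc m)
  then have "a * left_orbit a d \<mu> x m < 0" using \<open>\<mu> > 0\<close> by (simp add: left_orbit_Suc)
  then have "left_orbit a d \<mu> x m < 0" using \<open>a > 0\<close> by (simp add: mult_less_0_iff)
  with Suc show ?case by (cases "k = m") auto
qed simp

text \<open>Only the points before index \<open>k\<close> must lie on the left, so the formula still
  covers the step that returns to the right.\<close>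

lemma funpow_f_map_eq_left_orbit:
  assumes "x > 0" "\<And>j. j < k \<Longrightarrow> left_orbit a d \<mu> x j \<le> 0"
  shows "(f_map a d \<mu> ^^ Suc k) x = left_orbit a d \<mu> x k"
  using assms(2)
proof (induction k)
  case (Suc k)
  then show ?case
    by (simp add: f_map_def left_orbit_Suc)
qed (use \<open>x > 0\<close> in \<open>simp add: f_map_def\<close>)

text \<open>The return equation of one right and \<open>n - 1\<close> left steps, solved for the
  right-hand point. For \<open>n \<ge> 3\<close> the denominator is positive on the region and on
  the curve.\<close>

definition cycle_start :: "nat \<Rightarrow> real \<Rightarrow> real \<Rightarrow> real \<Rightarrow> real" where
  "cycle_start n a d \<mu> = \<mu> * geom_quotient (Suc n) a / (1 - a ^ (n - 1) * d)"

lemma geom_quotient_Suc: "n > 0 \<Longrightarrow> geom_quotient (Suc n) a = 1 + a * geom_quotient n a"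
  unfolding geom_quotient_def
  by (cases n) (simp_all add: sum.lessThan_Suc_shift sum_distrib_left del: sum.lessThan_Suc)

lemma geom_quotient_pos: "a > 0 \<Longrightarrow> n > 1 \<Longrightarrow> geom_quotient n a > 0"
  unfolding geom_quotient_def by (intro sum_pos) (auto simp: lessThan_empty_iff)

text \<open>Clearing the positive denominator leaves a polynomial in \<open>a\<close> and
  \<open>d\<close>; its sign separates the region from the curve, and its continuity is used for the
  frontier.\<close>

lemma region_pos_iff:
  "(a, d) \<in> region_pos n \<longleftrightarrow> a > 0 \<and> d * a ^ (n - 2) + geom_quotient n a < 0"
  by (auto simp: region_pos_def field_simps)

lemma curve_pos_iff:
  "(a, d) \<in> curve_pos n \<longleftrightarrow> a > 0 \<and> d * a ^ (n - 2) + geom_quotient n a = 0"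
  by (auto simp: curve_pos_def field_simps)

lemma power_minus_1_eq: "n \<ge> 2 \<Longrightarrow> a ^ (n - 1) = a * (a::real) ^ (n - 2)"
  by (simp flip: power_Suc add: numeral_2_eq_2 Suc_diff_Suc)

lemma left_orbit_periodic_iff:
  assumes "n > 0"
  shows "left_orbit a d \<mu> x (n - 1) = x \<longleftrightarrow> x * (1 - a ^ (n - 1) * d) = \<mu> * geom_quotient (Suc n) a"
  using assms by (auto simp: left_orbit_def geom_quotient_def algebra_simps)

text \<open>By the identity \<open>*\<close> the denominator of \<open>cycle_start\<close> is
  \<open>?S\<close> minus \<open>a\<close> times the polynomial. The sign of the polynomial thus
  compares the denominator with \<open>?S\<close>, and hence \<open>cycle_start\<close> with
  \<open>\<mu>\<close>.\<close>

lemma cycle_start_bounds: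
  assumes "n \<ge> 3" "\<mu> > 0" "a > 0"
  shows "d * a ^ (n - 2) + geom_quotient n a < 0 \<Longrightarrow> cycle_start n a d \<mu> < \<mu>" (is "?A \<Longrightarrow> _")
    and "d * a ^ (n - 2) + geom_quotient n a = 0 \<Longrightarrow> cycle_start n a d \<mu> = \<mu>" (is "?B \<Longrightarrow> _")
    and "d * a ^ (n - 2) + geom_quotient n a \<le> 0 \<Longrightarrow> cycle_start n a d \<mu> > 0 \<and> 1 - a ^ (n - 1) * d > 0"
      (is "?C \<Longrightarrow> _")
proof -
  let ?S = "geom_quotient (Suc n) a"
  have S: "?S > 0" using assms by (intro geom_quotient_pos) auto
  have *: "1 - a ^ (n - 1) * d = ?S - a * (d * a ^ (n - 2) + geom_quotient n a)"
    using assms(1) geom_quotient_Suc[of n a] power_minus_1_eq[of n a] by (simp add: algebra_simps)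
  { assume ?A
    then have "?S < 1 - a ^ (n - 1) * d"
      unfolding * using \<open>a > 0\<close> by (simp add: mult_pos_neg)
    then show "cycle_start n a d \<mu> < \<mu>"
      using S \<open>\<mu> > 0\<close> by (simp add: cycle_start_def divide_less_eq) }
  { assume ?B
    then have "1 - a ^ (n - 1) * d = ?S" unfolding * by simp
    then show "cycle_start n a d \<mu> = \<mu>" using S by (simp add: cycle_start_def) }
  { assume ?C
    then have "1 - a ^ (n - 1) * d > 0"
      unfolding * using \<open>a > 0\<close> S mult_nonneg_nonpos[of a "d * a ^ (n - 2) + geom_quotient n a"]
      by linarith
    then show "cycle_start n a d \<mu> > 0 \<and> 1 - a ^ (n - 1) * d > 0"
      using S \<open>\<mu> > 0\<close> by (simp add: cycle_start_def) }
qed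

lemma cycle_start_le:
  assumes "n \<ge> 3" "\<mu> > 0" "a > 0" "d * a ^ (n - 2) + geom_quotient n a \<le> 0"
  shows "cycle_start n a d \<mu> \<le> \<mu>"
  using cycle_start_bounds(1,2)[OF assms(1-3), of d] assms(4) by (auto simp: order_le_less)

section \<open>Construction of the cycle\<close>

text \<open>The second component is meant to solve \<open>(1 - A^n) Y = c\<close>, where
  \<open>c\<close> is the \<open>Y\<close>-part reached after \<open>n\<close> steps from
  \<open>Y = 0\<close>. The matrix does not depend on \<open>a\<close> and \<open>d\<close>, which
  keeps the formula easy to pass to the limit.\<close>

definition cycle_point ::
  "nat \<Rightarrow> real \<Rightarrow> real \<Rightarrow> real \<Rightarrow> real^'m^'m \<Rightarrow> real^'m \<Rightarrow> real^'m \<Rightarrow> real^'m \<Rightarrow> 'm state" where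
  "cycle_point n a d \<mu> A b e h =
     (cycle_start n a d \<mu>,
      matrix_inv (mat 1 - matrix_power A n) *v
        snd ((pwl_map a d \<mu> A b e h ^^ n) (cycle_start n a d \<mu>, 0)))"

text \<open>One formula serves the region and the curve, so convergence of the cycles at the curve
  is plain continuity.\<close>

definition RL_cycle ::
  "nat \<Rightarrow> real \<Rightarrow> real \<Rightarrow> real \<Rightarrow> real^'m^'m \<Rightarrow> real^'m \<Rightarrow> real^'m \<Rightarrow> real^'m \<Rightarrow> 'm state list" where
  "RL_cycle n a d \<mu> A b e h =
     map (\<lambda>k. (pwl_map a d \<mu> A b e h ^^ k) (cycle_point n a d \<mu> A b e h)) [0..<n]"

text \<open>The weak inequality treats region and curve together. They differ only in the last
  point, whose sign the fourth claim reads off from \<open>x - \<mu>\<close>.\<close>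

lemma funpow_cycle_start:
  assumes "n \<ge> 3" "\<mu> > 0" "a > 0" "d * a ^ (n - 2) + geom_quotient n a \<le> 0"
  defines "x \<equiv> cycle_start n a d \<mu>"
  shows "x > 0"
    and "(f_map a d \<mu> ^^ n) x = x"
    and "\<And>k. 0 < k \<Longrightarrow> k < n - 1 \<Longrightarrow> (f_map a d \<mu> ^^ k) x < 0"
    and "a * (f_map a d \<mu> ^^ (n - 1)) x = x - \<mu>"
proof -
  let ?y = "left_orbit a d \<mu> x"
  have x: "x > 0" "1 - a ^ (n - 1) * d > 0" "x \<le> \<mu>"
    using cycle_start_bounds(3)[OF assms(1-4)] cycle_start_le[OF assms(1-4)] by (simp_all add: x_def)
  have per: "?y (n - 1) = x"
    using left_orbit_periodic_iff[of n a d \<mu> x] assms(1) x(2) by (simp add: x_def cycle_start_def)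
  have "Suc (n - 2) = n - 1" using assms(1) by simp
  with left_orbit_Suc[of a d \<mu> x "n - 2"] per
  have last: "a * ?y (n - 2) = x - \<mu>" by simp
  \<comment> \<open>The left branch sends the last point to \<open>x \<le> \<mu>\<close>; this
    starts the backward argument of \<open>left_orbit_neg\<close>.\<close>
  with x(3) \<open>a > 0\<close> have le: "?y (n - 2) \<le> 0"
    by (metis diff_le_0_iff_le mult_le_0_iff not_le)
  have neg: "?y k < 0" if "k < n - 2" for k
    using left_orbit_neg[OF assms(3,2) le that] .
  have nonpos: "?y k \<le> 0" if "k < n - 1" for k
    using neg[of k] le that by (cases "k = n - 2") force+
  have eq: "(f_map a d \<mu> ^^ Suc k) x = ?y k" if "k \<le> n - 1" for k
    using that by (intro funpow_f_map_eq_left_orbit x nonpos) simp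
  show "x > 0" by fact
  show "(f_map a d \<mu> ^^ n) x = x" using eq[of "n - 1"] per assms(1) by simp
  show "(f_map a d \<mu> ^^ k) x < 0" if "0 < k" "k < n - 1" for k
    using eq[of "k - 1"] neg[of "k - 1"] that by simp
  show "a * (f_map a d \<mu> ^^ (n - 1)) x = x - \<mu>"
    using eq[of "n - 2"] last \<open>Suc (n - 2) = n - 1\<close> by simp
qed

lemma map_upt_eq_replicate:
  assumes "n \<ge> 2" "g 0 = s" "\<And>k. 0 < k \<Longrightarrow> k < n - 1 \<Longrightarrow> g k = t" "g (n - 1) = u"
  shows "map g [0..<n] = s # replicate (n - 2) t @ [u]"
proof -
  obtain m where n: "n = Suc (Suc m)" using assms(1) by (metis add_2_eq_Suc le_Suc_ex)
  have "map (\<lambda>k. g (Suc k)) [0..<m] = replicate m t"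
    using assms(3) by (intro nth_equalityI) (auto simp: n)
  then have "map g (map Suc [0..<Suc m]) = replicate m t @ [u]"
    using assms(4) by (simp add: n o_def)
  then show ?thesis
    using assms(2) by (simp add: n upt_conv_Cons map_Suc_upt del: upt_Suc)
qed

lemma RL_cycle:
  fixes A :: "real^'m^'m"
  assumes "n \<ge> 3" "\<not> eigenvalue (matrix_power A n) 1" "\<mu> > 0"
  shows "(a, d) \<in> region_pos n \<Longrightarrow>
      cycle_with (pwl_map a d \<mu> A b e h) (SymR # replicate (n - 1) SymL) (RL_cycle n a d \<mu> A b e h)"
    and "(a, d) \<in> curve_pos n \<Longrightarrow>
      cycle_with (pwl_map a d \<mu> A b e h) (SymR # replicate (n - 2) SymL @ [Sym0])
        (RL_cycle n a d \<mu> A b e h)"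
proof -
  let ?F = "pwl_map a d \<mu> A b e h" and ?z = "cycle_point n a d \<mu> A b e h"
  let ?x = "cycle_start n a d \<mu>"
  let ?f = "\<lambda>k. (f_map a d \<mu> ^^ k) ?x"
  let ?B = "mat 1 - matrix_power A n"
  have fst_z: "fst ((?F ^^ k) ?z) = ?f k" for k
    by (simp add: cycle_point_def fst_funpow_pwl_map)
  \<comment> \<open>By \<open>snd_funpow_pwl_map\<close>, the equation solved by
    \<open>snd ?z\<close> says that the \<open>Y\<close>-part returns after \<open>n\<close>
    steps.\<close>
  have "?B *v snd ?z = snd ((?F ^^ n) (?x, 0))"
    using invertible_if_no_unit_eigenvalue[OF assms(2)]
    by (simp add: cycle_point_def matrix_vector_mul_assoc matrix_inv_right)
  then have "snd ?z - matrix_power A n *v snd ?z = snd ((?F ^^ n) (?x, 0))"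
    unfolding matrix_vector_mult_diff_rdistrib matrix_vector_mul_lid .
  then have fixed: "matrix_power A n *v snd ?z + snd ((?F ^^ n) (?x, 0)) = snd ?z"
    unfolding diff_eq_eq by (simp only: add.commute)
  have "?z = (?x, snd ?z)" by (simp add: cycle_point_def)
  then have "snd ((?F ^^ n) ?z) = snd ((?F ^^ n) (?x, snd ?z))" by (rule arg_cong)
  with fixed have snd_z: "snd ((?F ^^ n) ?z) = snd ?z"
    unfolding snd_funpow_pwl_map[of n a d \<mu> A b e h ?x "snd ?z"] by (rule trans[rotated])
  have split: "i = 0 \<or> 0 < i \<and> i < n - 1 \<or> i = n - 1" if "i < n" for i using that by linarith
  have cyc: "is_cycle ?F (RL_cycle n a d \<mu> A b e h)"
    if a: "a > 0" and le: "d * a ^ (n - 2) + geom_quotient n a \<le> 0"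
  proof -
    note f = funpow_cycle_start[OF assms(1,3) a le]
    have "cycle_start n a d \<mu> \<le> \<mu>"
      by (rule cycle_start_le[OF assms(1,3) a le])
    with f(4) a have "?f (n - 1) \<le> 0"
      by (metis diff_le_0_iff_le mult_le_0_iff not_le)
    with f(3) have nonpos: "?f k \<le> 0" if "0 < k" "k < n" for k
      using that split[of k] by (auto intro: less_imp_le)
    have "(?F ^^ n) ?z = ?z"
      by (rule prod_eqI) (simp add: fst_z f(2), simp add: cycle_point_def, rule snd_z)
    \<comment> \<open>The start is the only point with positive \<open>x\<close>, so no earlier
      return is possible.\<close>
    moreover have "(?F ^^ k) ?z \<noteq> ?z" if "0 < k" "k < n" for k
    proof
      assume "(?F ^^ k) ?z = ?z"
      then have "?f k = ?x" unfolding fst_z[symmetric] by (simp add: cycle_point_def)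
      with nonpos[OF that] f(1) show False by simp
    qed
    ultimately show ?thesis
      unfolding RL_cycle_def using assms(1) by (intro is_cycle_iterates) auto
  qed
  have sym: "symbolic_sequence (RL_cycle n a d \<mu> A b e h) = map (\<lambda>k. symbol_of (?f k)) [0..<n]"
    by (simp add: symbolic_sequence_def RL_cycle_def fst_z)
  show "cycle_with ?F (SymR # replicate (n - 1) SymL) (RL_cycle n a d \<mu> A b e h)"
    if "(a, d) \<in> region_pos n"
  proof -
    from that have a: "a > 0" and lt: "d * a ^ (n - 2) + geom_quotient n a < 0"
      by (auto simp: region_pos_iff)
    note f = funpow_cycle_start[OF assms(1,3) a less_imp_le[OF lt]]
    have "a * ?f (n - 1) < 0"
      unfolding f(4) using cycle_start_bounds(1)[OF assms(1,3) a lt] by simp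
    with a have "?f (n - 1) < 0" by (simp add: mult_less_0_iff)
    then have "map (\<lambda>k. symbol_of (?f k)) [0..<n] = SymR # replicate (n - 2) SymL @ [SymL]"
      using f(1,3) assms(1) by (intro map_upt_eq_replicate) (auto simp: symbol_of_def dest: less_asym)
    also have "\<dots> = SymR # replicate (n - 1) SymL"
      using assms(1) by (simp add: replicate_append_same Suc_diff_Suc numeral_2_eq_2 flip: replicate_Suc)
    finally have "map (\<lambda>k. symbol_of (?f k)) [0..<n] = SymR # replicate (n - 1) SymL" .
    with cyc[OF a less_imp_le[OF lt]] sym show ?thesis by (simp add: cycle_with_def)
  qed
  show "cycle_with ?F (SymR # replicate (n - 2) SymL @ [Sym0]) (RL_cycle n a d \<mu> A b e h)"
    if "(a, d) \<in> curve_pos n"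
  proof -
    from that have a: "a > 0" and eq: "d * a ^ (n - 2) + geom_quotient n a = 0"
      by (auto simp: curve_pos_iff)
    note f = funpow_cycle_start[OF assms(1,3) a eq_refl[OF eq]]
    have "?f (n - 1) = 0"
      using f(4) cycle_start_bounds(2)[OF assms(1,3) a eq] a by simp
    then have "map (\<lambda>k. symbol_of (?f k)) [0..<n] = SymR # replicate (n - 2) SymL @ [Sym0]"
      using f(1,3) assms(1) by (intro map_upt_eq_replicate) (auto simp: symbol_of_def dest: less_asym)
    with cyc[OF a eq_refl[OF eq]] sym show ?thesis by (simp add: cycle_with_def)
  qed
qed

section \<open>Necessity of the region\<close>

text \<open>A border collision bifurcation refers to the frontier of the full existence set, so the
  region must be shown necessary as well.\<close>

lemma RL_cycle_imp_region:
  assumes n: "n \<ge> 3" and \<mu>: "\<mu> > 0"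
    and cyc: "cycle_with (pwl_map a d \<mu> A b e h) (SymR # replicate (n - 1) SymL) Z"
  shows "(a, d) \<in> region_pos n"
proof -
  define X where "X i = fst (Z ! i)" for i
  have sym: "map (\<lambda>z. symbol_of (fst z)) Z = SymR # replicate (n - 1) SymL"
    and Z: "is_cycle (pwl_map a d \<mu> A b e h) Z"
    using cyc by (auto simp: cycle_with_def symbolic_sequence_def)
  have len: "length Z = n" using arg_cong[OF sym, of length] n by simp
  have sym_nth: "symbol_of (X i) = (SymR # replicate (n - 1) SymL) ! i" if "i < n" for i
    unfolding X_def using that len by (simp only: sym[symmetric] nth_map)
  have X0: "X 0 > 0" using sym_nth[of 0] n by (auto simp: symbol_of_def split: if_splits)
  have neg: "X i < 0" if "0 < i" "i < n" for i
    using sym_nth[of i] that by (auto simp: symbol_of_def nth_Cons split: if_splits nat.splits)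
  have step: "X (Suc i mod n) = f_map a d \<mu> (X i)" if "i < n" for i
    using is_cycle_nth[OF Z, of i, symmetric] len that by (simp add: X_def pwl_map_def split_beta)
  have orbit: "X (Suc k mod n) = left_orbit a d \<mu> (X 0) k" if "k < n" for k
    using that
  proof (induction k)
    case 0
    then show ?case using step[of 0] X0 n by (simp add: f_map_def)
  next
    case (Suc k)
    then show ?case using step[of "Suc k"] neg[of "Suc k"] by (simp add: f_map_def left_orbit_Suc)
  qed
  \<comment> \<open>As \<open>n \<ge> 3\<close>, two consecutive points lie on the left, and
    \<open>a * X 1 = X 2 - \<mu> < 0\<close> forces \<open>a > 0\<close>.\<close>
  have "X 2 < 0" "X 1 < 0" using neg n by auto
  moreover have "X 2 = a * X 1 + \<mu>"
    using step[of 1] n \<open>X 1 < 0\<close> by (simp add: f_map_def numeral_2_eq_2)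
  ultimately have "a * X 1 < 0" using \<mu> by linarith
  with \<open>X 1 < 0\<close> have a: "a > 0" by (simp add: mult_less_0_iff)
  have "X 0 = a * X (n - 1) + \<mu>"
    using step[of "n - 1"] neg[of "n - 1"] n by (simp add: f_map_def)
  then have lt: "X 0 < \<mu>" using neg[of "n - 1"] n a by (simp add: mult_pos_neg)
  let ?S = "geom_quotient (Suc n) a"
  have S: "?S > 0" using a n by (intro geom_quotient_pos) auto
  have eq: "X 0 * (1 - a ^ (n - 1) * d) = \<mu> * ?S"
    using left_orbit_periodic_iff[of n a d \<mu> "X 0"] orbit[of "n - 1"] n by simp
  \<comment> \<open>The factor of \<open>X 0\<close> is positive, and it exceeds \<open>?S\<close>
    because \<open>X 0 < \<mu>\<close>; this is the inequality of the region multiplied by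
    \<open>a\<close>.\<close>
  then have "1 - a ^ (n - 1) * d > 0"
    using X0 S \<mu> by (metis mult_pos_pos zero_less_mult_pos)
  then have "\<mu> * ?S < \<mu> * (1 - a ^ (n - 1) * d)"
    unfolding eq[symmetric] using lt by simp
  then have "?S < 1 - a ^ (n - 1) * d" using \<mu> by simp
  then have "a * (d * a ^ (n - 2) + geom_quotient n a) < 0"
    using n geom_quotient_Suc[of n a] power_minus_1_eq[of n a] by (simp add: algebra_simps)
  with a show ?thesis by (simp add: region_pos_iff mult_less_0_iff)
qed

lemma existence_set_RL:
  fixes A :: "real^'m^'m"
  assumes "n \<ge> 3" "\<not> eigenvalue (matrix_power A n) 1" "\<mu> > 0"
  shows "existence_set (\<lambda>(a, d). pwl_map a d \<mu> A b e h) (SymR # replicate (n - 1) SymL) = region_pos n"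
  unfolding existence_set_def
  using RL_cycle(1)[OF assms] RL_cycle_imp_region[OF assms(1,3)] by fast

section \<open>Frontier of the region\<close>

text \<open>As \<open>a\<close> tends to \<open>0\<close> from above, the curve runs off to \<open>d = -\<infinity>\<close>, so the axis \<open>a = 0\<close>
  contributes nothing to the frontier: multiplied by \<open>a ^ (n - 2)\<close>, the defining inequality
  reads \<open>1 \<le> 0\<close> there.\<close>

lemma frontier_region_pos:
  assumes "n \<ge> 3"
  shows "frontier (region_pos n) = curve_pos n"
proof -
  let ?g = "\<lambda>p :: real \<times> real. snd p * fst p ^ (n - 2) + geom_quotient n (fst p)"
  let ?C = "{p :: real \<times> real. 0 \<le> fst p} \<inter> {p. ?g p \<le> 0}"
  have cont: "continuous_on UNIV ?g"
    unfolding geom_quotient_def by (intro continuous_intros)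
  have region: "region_pos n = {p. 0 < fst p} \<inter> {p. ?g p < 0}"
    by (auto simp: region_pos_iff)
  have "open (region_pos n)"
    unfolding region by (intro open_Int open_Collect_less continuous_intros cont)
  then have int: "interior (region_pos n) = region_pos n" by (rule interior_open)
  have gq0: "geom_quotient n 0 = 1"
    using assms geom_quotient_Suc[of "n - 1" 0] by simp
  have C: "?C = region_pos n \<union> curve_pos n"
  proof -
    have "\<not> d * 0 ^ (n - 2) + geom_quotient n 0 \<le> 0" for d
      using assms gq0 by (simp add: zero_power)
    then have "(a, d) \<in> ?C \<longleftrightarrow> (a, d) \<in> region_pos n \<union> curve_pos n" for a d
      by (cases "a = 0") (auto simp: region_pos_iff curve_pos_iff order_le_less)
    then show ?thesis by (intro set_eqI) (simp only: split_paired_all)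
  qed
  \<comment> \<open>Weak inequalities between continuous functions define a closed set, so region
    and curve together bound the closure from above.\<close>
  have "closed ?C"
    by (intro closed_Int closed_Collect_le continuous_intros cont)
  then have "closure (region_pos n) \<subseteq> region_pos n \<union> curve_pos n"
    unfolding C by (intro closure_minimal) auto
  moreover have "p \<in> closure (region_pos n)" if "p \<in> curve_pos n" for p
  proof -
    obtain a d where p: "p = (a, d)" by (cases p)
    \<comment> \<open>Lowering \<open>d\<close> at fixed \<open>a > 0\<close> enters the region, so
      a point of the curve is the limit of points straight below it.\<close>
    have "(a, d - 1 / real (Suc k)) \<in> region_pos n" for k
    proof -
      have a: "a > 0" and eq: "d * a ^ (n - 2) + geom_quotient n a = 0"
        using that by (auto simp: p curve_pos_iff)
      then have "1 / real (Suc k) * a ^ (n - 2) > 0" by simp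
      with eq have "(d - 1 / real (Suc k)) * a ^ (n - 2) + geom_quotient n a < 0"
        unfolding left_diff_distrib by linarith
      with a show ?thesis by (simp add: region_pos_iff)
    qed
    moreover have "(\<lambda>k. (a, d - 1 / real (Suc k))) \<longlonglongrightarrow> (a, d - 0)"
      by (intro tendsto_intros LIMSEQ_Suc[OF lim_inverse_n'])
    ultimately show ?thesis
      unfolding closure_sequential p by (intro exI[of _ "\<lambda>k. (a, d - 1 / real (Suc k))"]) simp
  qed
  moreover have "region_pos n \<inter> curve_pos n = {}"
    by (auto simp: region_pos_def curve_pos_def)
  ultimately show ?thesis
    unfolding frontier_def int using closure_subset[of "region_pos n"] by blast
qed

section \<open>Convergence to the colliding cycle\<close>

text \<open>The only division by a varying quantity is in \<open>cycle_start\<close>, and its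
  denominator is positive on the curve.\<close>

lemma tendsto_RL_cycle:
  fixes A :: "real^'m^'m"
  assumes "n \<ge> 3" "\<mu> > 0" "(a0, d0) \<in> curve_pos n" "i < n"
  shows "((\<lambda>p. RL_cycle n (fst p) (snd p) \<mu> A b e h ! i) \<longlongrightarrow> RL_cycle n a0 d0 \<mu> A b e h ! i)
           (at (a0, d0) within U)"
proof -
  let ?G = "at (a0, d0) within U"
  have fst: "(fst \<longlongrightarrow> a0) ?G" and snd: "(snd \<longlongrightarrow> d0) ?G"
    by (auto intro!: tendsto_eq_intros)
  have "1 - a0 ^ (n - 1) * d0 \<noteq> 0"
    using cycle_start_bounds(3)[OF assms(1,2), of a0 d0] assms(3) by (auto simp: curve_pos_iff)
  then have start: "((\<lambda>p. cycle_start n (fst p) (snd p) \<mu>) \<longlongrightarrow> cycle_start n a0 d0 \<mu>) ?G"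
    unfolding cycle_start_def geom_quotient_def by (intro tendsto_intros fst snd)
  have "((\<lambda>p. cycle_point n (fst p) (snd p) \<mu> A b e h) \<longlongrightarrow> cycle_point n a0 d0 \<mu> A b e h) ?G"
    unfolding cycle_point_def
    by (intro tendsto_intros fst snd start tendsto_funpow_pwl_map
        matrix_vector_mul_bounded_linear[THEN bounded_linear.tendsto])
  from tendsto_funpow_pwl_map[OF fst snd this] show ?thesis
    using assms(4) by (simp add: RL_cycle_def)
qed

lemma border_collision_RL:
  fixes A :: "real^'m^'m"
  assumes "n \<ge> 3" "\<not> eigenvalue (matrix_power A n) 1" "\<mu> > 0" "p \<in> curve_pos n"
  shows "border_collision_bifurcation (\<lambda>(a, d). pwl_map a d \<mu> A b e h)
           (SymR # replicate (n - 1) SymL) p (SymR # replicate (n - 2) SymL @ [Sym0])"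
proof -
  obtain a0 d0 where p: "p = (a0, d0)" by (cases p)
  let ?s = "SymR # replicate (n - 1) SymL" and ?\<sigma> = "SymR # replicate (n - 2) SymL @ [Sym0]"
  let ?\<Phi> = "\<lambda>(a, d). pwl_map a d \<mu> A b e h"
  let ?Z = "\<lambda>p. RL_cycle n (fst p) (snd p) \<mu> A b e h"
  have len: "length ?\<sigma> = n" using assms(1) by simp
  have "cycle_with (?\<Phi> p) ?\<sigma> (?Z p)"
    using RL_cycle(2)[OF assms(1-3)] assms(4) by (simp add: p)
  moreover have "\<forall>q \<in> region_pos n. cycle_with (?\<Phi> q) ?s (?Z q)"
    using RL_cycle(1)[OF assms(1-3)] by auto
  moreover have "((\<lambda>q. ?Z q ! i) \<longlongrightarrow> ?Z p ! i) (at p within region_pos n)" if "i < n" for i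
    using tendsto_RL_cycle[OF assms(1,3) _ that] assms(4) by (simp add: p)
  ultimately have "\<exists>Z0 Z. cycle_with (?\<Phi> p) ?\<sigma> Z0 \<and>
      (\<forall>q \<in> region_pos n. cycle_with (?\<Phi> q) ?s (Z q)) \<and>
      (\<forall>i < n. ((\<lambda>q. Z q ! i) \<longlongrightarrow> Z0 ! i) (at p within region_pos n))"
    by (intro exI[of _ "?Z p"] exI[of _ ?Z]) blast
  then show ?thesis
    unfolding border_collision_bifurcation_def len existence_set_RL[OF assms(1-3)]
      frontier_region_pos[OF assms(1)]
    using assms(1,4) by simp
qed

subsection \<open>Reflection in the switching boundary\<close>

definition reflect :: "'m state \<Rightarrow> 'm state" where
  "reflect z = (- fst z, snd z)"

fun flip :: "symbol \<Rightarrow> symbol" where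
  "flip SymL = SymR" | "flip SymR = SymL" | "flip Sym0 = Sym0"

lemma reflect_reflect [simp]: "reflect (reflect z) = z"
  by (simp add: reflect_def)

lemma inj_reflect: "inj reflect"
  by (metis injI reflect_reflect)

lemma flip_flip [simp]: "flip (flip s) = s"
  by (cases s) auto

lemma symbolic_sequence_reflect: "symbolic_sequence (map reflect Z) = map flip (symbolic_sequence Z)"
  by (auto simp: symbolic_sequence_def symbol_of_def reflect_def)

text \<open>Reflection exchanges the two branches; \<open>b\<close> and \<open>e\<close> also change
  sign because \<open>x\<close> does. At \<open>x = 0\<close> both branches agree.\<close>

lemma pwl_map_reflect:
  "pwl_map a d \<mu> A b e h (reflect z) = reflect (pwl_map d a (- \<mu>) A (- e) (- b) h z)"
  by (auto simp: pwl_map_def f_map_def G_map_def reflect_def split_beta)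

lemma cycle_with_reflect:
  assumes "cycle_with (pwl_map d a (- \<mu>) A (- e) (- b) h) s Z"
  shows "cycle_with (pwl_map a d \<mu> A b e h) (map flip s) (map reflect Z)"
proof -
  have "map (pwl_map a d \<mu> A b e h) (map reflect Z)
      = map reflect (map (pwl_map d a (- \<mu>) A (- e) (- b) h) Z)"
    by (simp add: pwl_map_reflect)
  also have "\<dots> = map reflect (rotate1 Z)"
    using assms by (simp only: cycle_with_def is_cycle_def)
  finally show ?thesis
    using assms inj_reflect
    by (auto simp: cycle_with_def is_cycle_def symbolic_sequence_reflect rotate1_map distinct_map
        intro: inj_on_subset)
qed

lemma existence_set_reflect:
  "existence_set (\<lambda>(a, d). pwl_map a d \<mu> A b e h) (map flip s) =
   prod.swap ` existence_set (\<lambda>(a, d). pwl_map a d (- \<mu>) A (- e) (- b) h) s" (is "?L = ?R")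
proof
  show "?R \<subseteq> ?L"
    by (auto simp: existence_set_def dest!: cycle_with_reflect)
  show "?L \<subseteq> ?R"
  proof
    fix p assume "p \<in> ?L"
    then obtain a d Z where p: "p = (a, d)"
      and Z: "cycle_with (pwl_map a d \<mu> A b e h) (map flip s) Z"
      by (cases p) (auto simp: existence_set_def)
    \<comment> \<open>Reflection is an involution, so the same lemma with exchanged and negated data
      leads back.\<close>
    have "cycle_with (pwl_map d a (- \<mu>) A (- e) (- b) h) s (map reflect Z)"
      using cycle_with_reflect[of a d "- \<mu>" A "- b" "- e" h "map flip s" Z] Z by (simp add: o_def)
    then show "p \<in> ?R"
      unfolding p by (intro image_eqI[of _ _ "(d, a)"]) (auto simp: existence_set_def)
  qed
qed

text \<open>A linear bijection of the plane commutes with closure and interior.\<close>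

lemma frontier_swap:
  fixes S :: "(real \<times> real) set"
  shows "frontier (prod.swap ` S) = prod.swap ` frontier S"
proof -
  have lin: "linear (prod.swap :: real \<times> real \<Rightarrow> real \<times> real)"
    by (intro linearI) auto
  have "closure (prod.swap ` S) = prod.swap ` closure S"
    using lin by (intro closure_injective_linear_image[symmetric]) auto
  moreover have "interior (prod.swap ` S) = prod.swap ` interior S"
    using lin by (intro interior_injective_linear_image) auto
  ultimately show ?thesis by (simp add: frontier_def image_set_diff)
qed

lemma border_collision_reflect:
  fixes A :: "real^'m^'m"
  assumes "border_collision_bifurcation (\<lambda>(a, d). pwl_map a d (- \<mu>) A (- e) (- b) h) s p \<sigma>"
  shows "border_collision_bifurcation (\<lambda>(a, d). pwl_map a d \<mu> A b e h)
           (map flip s) (prod.swap p) (map flip \<sigma>)"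
proof -
  let ?\<Phi> = "\<lambda>(a, d). pwl_map a d \<mu> A b e h"
  let ?\<Psi> = "\<lambda>(a, d). pwl_map a d (- \<mu>) A (- e) (- b) h"
  let ?E = "existence_set ?\<Psi> s"
  have flip: "Sym0 = flip y \<longleftrightarrow> Sym0 = y" for y by (cases y) auto
  obtain Z0 Z where len: "length s = length \<sigma>" "Sym0 \<notin> set s" "Sym0 \<in> set \<sigma>" "p \<in> frontier ?E"
    and Z0: "cycle_with (?\<Psi> p) \<sigma> Z0"
    and Z: "\<And>q. q \<in> ?E \<Longrightarrow> cycle_with (?\<Psi> q) s (Z q)"
    and lim: "\<And>i. i < length \<sigma> \<Longrightarrow> ((\<lambda>q. Z q ! i) \<longlongrightarrow> Z0 ! i) (at p within ?E)"
    using assms unfolding border_collision_bifurcation_def by blast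
  have lenZ: "length (Z q) = length \<sigma>" if "q \<in> ?E" for q
    using Z[OF that] len(1) by (auto simp: cycle_with_def symbolic_sequence_def)
  have lenZ0: "length Z0 = length \<sigma>"
    using Z0 by (auto simp: cycle_with_def symbolic_sequence_def)
  have "(prod.swap \<longlongrightarrow> p) (at (prod.swap p) within prod.swap ` ?E)"
    unfolding prod.swap_def by (auto intro!: tendsto_eq_intros)
  \<comment> \<open>The target filter is punctured: \<open>prod.swap q\<close> must avoid
    \<open>p\<close>, which follows from injectivity.\<close>
  then have swap: "filterlim prod.swap (at p within ?E) (at (prod.swap p) within prod.swap ` ?E)"
    by (auto simp: filterlim_at eventually_at_filter prod_eq_iff intro!: always_eventually)
  have "((\<lambda>q. map reflect (Z (prod.swap q)) ! i) \<longlongrightarrow> map reflect Z0 ! i)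
          (at (prod.swap p) within prod.swap ` ?E)" if "i < length \<sigma>" for i
  proof -
    have "((\<lambda>q. reflect (Z (prod.swap q) ! i)) \<longlongrightarrow> reflect (Z0 ! i))
          (at (prod.swap p) within prod.swap ` ?E)"
      unfolding reflect_def by (intro tendsto_intros filterlim_compose[OF lim[OF that] swap])
    \<comment> \<open>The length of \<open>Z q\<close> is known only for \<open>q\<close> in the
      existence set, so the two expressions agree only eventually.\<close>
    moreover have "\<forall>\<^sub>F q in at (prod.swap p) within prod.swap ` ?E.
        reflect (Z (prod.swap q) ! i) = map reflect (Z (prod.swap q)) ! i"
      unfolding eventually_at_filter using that lenZ by (intro always_eventually) auto
    ultimately show ?thesis
      using that lenZ0 by (auto intro: Lim_transform_eventually)
  qed
  moreover have "cycle_with (?\<Phi> (prod.swap q)) (map flip t) (map reflect W)"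
    if "cycle_with (?\<Psi> q) t W" for q t W
    using that by (auto simp: split_beta intro: cycle_with_reflect)
  moreover have "prod.swap p \<in> frontier (prod.swap ` ?E)"
    using len(4) by (simp add: frontier_swap)
  ultimately show ?thesis
    unfolding border_collision_bifurcation_def existence_set_reflect
    using len Z0 Z flip
    by (intro conjI exI[of _ "map reflect Z0"] exI[of _ "\<lambda>q. map reflect (Z (prod.swap q))"])
       (auto simp: image_iff)
qed

lemma region_neg_eq_swap: "region_neg n = prod.swap ` region_pos n"
  by (force simp: region_neg_def region_pos_def)

lemma curve_neg_eq_swap: "curve_neg n = prod.swap ` curve_pos n"
  by (force simp: curve_neg_def curve_pos_def)

section \<open>The result for both signs of \<open>\<mu>\<close>\<close>

theorem proposition1:
  fixes A :: "real^'m^'m" and b e h :: "real^'m" and n :: nat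
  assumes "n \<ge> 3"
    and "\<not> eigenvalue (matrix_power A n) 1"
  shows
    "(\<forall>\<mu> > 0. \<forall>(a, d) \<in> region_pos n.
        \<exists>Z. cycle_with (pwl_map a d \<mu> A b e h) (SymR # replicate (n - 1) SymL) Z)
   \<and> (\<forall>\<mu> > 0. \<forall>p \<in> curve_pos n.
        border_collision_bifurcation (\<lambda>(a, d). pwl_map a d \<mu> A b e h)
          (SymR # replicate (n - 1) SymL) p (SymR # replicate (n - 2) SymL @ [Sym0]))
   \<and> frontier (region_pos n) = curve_pos n
   \<and> (\<forall>\<mu> < 0. \<forall>(a, d) \<in> region_neg n.
        \<exists>Z. cycle_with (pwl_map a d \<mu> A b e h) (SymL # replicate (n - 1) SymR) Z)
   \<and> (\<forall>\<mu> < 0. \<forall>p \<in> curve_neg n.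
        border_collision_bifurcation (\<lambda>(a, d). pwl_map a d \<mu> A b e h)
          (SymL # replicate (n - 1) SymR) p (SymL # replicate (n - 2) SymR @ [Sym0]))
   \<and> frontier (region_neg n) = curve_neg n"
proof (intro conjI allI impI ballI)
  have flip: "SymL # replicate (n - 1) SymR = map flip (SymR # replicate (n - 1) SymL)"
    "SymL # replicate (n - 2) SymR @ [Sym0] = map flip (SymR # replicate (n - 2) SymL @ [Sym0])"
    by simp_all
  show "case p of (a, d) \<Rightarrow>
      \<exists>Z. cycle_with (pwl_map a d \<mu> A b e h) (SymR # replicate (n - 1) SymL) Z"
    if "\<mu> > 0" and "p \<in> region_pos n" for \<mu> p
    using RL_cycle(1)[OF assms that(1)] that(2) by fast
  show "border_collision_bifurcation (\<lambda>(a, d). pwl_map a d \<mu> A b e h)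
      (SymR # replicate (n - 1) SymL) p (SymR # replicate (n - 2) SymL @ [Sym0])"
    if "\<mu> > 0" "p \<in> curve_pos n" for \<mu> p
    using border_collision_RL[OF assms that] .
  show "frontier (region_pos n) = curve_pos n"
    using frontier_region_pos[OF assms(1)] .
  show "case p of (a, d) \<Rightarrow>
      \<exists>Z. cycle_with (pwl_map a d \<mu> A b e h) (SymL # replicate (n - 1) SymR) Z"
    if "\<mu> < 0" and p': "p \<in> region_neg n" for \<mu> p
  proof -
    obtain a d where p: "p = (a, d)" "(d, a) \<in> region_pos n"
      using p' by (auto simp: region_neg_eq_swap)
    have "- \<mu> > 0" using that by simp
    \<comment> \<open>The positive case is applied to \<open>- \<mu>\<close> with slopes exchanged
      and vectors \<open>- e\<close>, \<open>- b\<close>, the data that reflect to the given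
      system.\<close>
    from cycle_with_reflect[OF RL_cycle(1)[OF assms this p(2), of "- e" "- b" h]]
    show ?thesis unfolding p(1) flip by auto
  qed
  show "border_collision_bifurcation (\<lambda>(a, d). pwl_map a d \<mu> A b e h)
      (SymL # replicate (n - 1) SymR) p (SymL # replicate (n - 2) SymR @ [Sym0])"
    if "\<mu> < 0" and p': "p \<in> curve_neg n" for \<mu> p
  proof -
    obtain q where p: "p = prod.swap q" "q \<in> curve_pos n"
      using p' by (auto simp: curve_neg_eq_swap)
    have "- \<mu> > 0" using that by simp
    from border_collision_reflect[OF border_collision_RL[OF assms this p(2), of "- e" "- b" h]]
    show ?thesis unfolding p(1) flip .
  qed
  show "frontier (region_neg n) = curve_neg n"
    unfolding region_neg_eq_swap curve_neg_eq_swap frontier_swap frontier_region_pos[OF assms(1)] ..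
qed

end
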